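(* Let $k\ge 0$ be an integer and let $S=\partial([0,1]^2)\subset\mathbb{R}^2$ be the square. Suppose $\varphi:S\to S$ is a $C^{k+1}$ diffeomorphism of the square that maps each of the four sides of $S$ to itself, and such that each of the four resulting diffeomorphisms of the unit interval $[0,1]$ has derivative equal to $1$ at both endpoints (that is, the derivative of $\varphi$ equals $1$ at each vertex of $S$). Then there exists a $C^k$ diffeomorphism $\psi:\mathbb{R}^2\to\mathbb{R}^2$ such that $\psi=\varphi$ on $S$ and $\psi$ is area preserving.
   Context: A map $\varphi:S\to S$ is called a $C^{m}$ diffeomorphism of the square if there exists a $C^{m}$ diffeomorphism $\Psi:\mathbb{R}^2\to\mathbb{R}^2$ with $\Psi|_S=\varphi$. Each side of $S$ is identified with $[0,1]$ in the obvious way by its non-constant coordinate. A $C^0$ diffeomorphism means a homeomorphism. Area preserving means preserving Lebesgue measure on $\mathbb{R}^2$. *)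

theory Defs
  imports "HOL-Analysis.Analysis"
begin

text \<open>In finite dimension, continuity of all iterated directional derivatives is equivalent
  to continuity of the iterated total derivative; the formulation through directions keeps the
  codomain type fixed along the recursion.\<close>

primrec Ck_map :: "nat \<Rightarrow> ('a::euclidean_space \<Rightarrow> 'b::real_normed_vector) \<Rightarrow> bool" where
  "Ck_map 0 f \<longleftrightarrow> continuous_on UNIV f"
| "Ck_map (Suc n) f \<longleftrightarrow>
     (\<forall>x. f differentiable (at x)) \<and> (\<forall>v. Ck_map n (\<lambda>x. frechet_derivative f (at x) v))"

definition Ck_diffeo :: "nat \<Rightarrow> ('a::euclidean_space \<Rightarrow> 'a) \<Rightarrow> bool" where
  "Ck_diffeo m f \<longleftrightarrow> bij f \<and> Ck_map m f \<and> Ck_map m (inv f)"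

definition square :: "(real \<times> real) set" where
  "square = frontier ({0..1} \<times> {0..1})"

definition horizontal_side :: "real \<Rightarrow> (real \<times> real) set" where
  "horizontal_side c = {0..1} \<times> {c}"

definition vertical_side :: "real \<Rightarrow> (real \<times> real) set" where
  "vertical_side c = {c} \<times> {0..1}"

text \<open>Values outside the square are irrelevant.\<close>

definition square_diffeo :: "nat \<Rightarrow> (real \<times> real \<Rightarrow> real \<times> real) \<Rightarrow> bool" where
  "square_diffeo m \<phi> \<longleftrightarrow>
     \<phi> \<in> square \<rightarrow> square \<and> (\<exists>\<Psi>. Ck_diffeo m \<Psi> \<and> (\<forall>p\<in>square. \<Psi> p = \<phi> p))"

definition area_preserving :: "(real \<times> real \<Rightarrow> real \<times> real) \<Rightarrow> bool" where
  "area_preserving \<psi> \<longleftrightarrow>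
     \<psi> \<in> lebesgue \<rightarrow>\<^sub>M lebesgue \<and>
     (\<forall>A\<in>sets lebesgue. emeasure lebesgue (\<psi> -` A) = emeasure lebesgue A)"

end

theory Submission
  imports Defs
begin

text \<open>
  Each side is treated separately by a map \<open>T\<close> that is \<open>\<phi>\<close> on that side and the identity on the
  other three; the composition of the four maps is \<open>\<psi>\<close>. For the side \<open>y = c\<close>, where \<open>\<phi>\<close> acts as
  \<open>x \<mapsto> x + h x\<close>, take a function \<open>A\<close> with \<open>A 0 = A 1 = 0\<close>, \<open>A' c = 1\<close>, \<open>A' (1 - c) = 0\<close>, and let \<open>T\<close> be
  given by the generating function \<open>x Y + A Y h x\<close>: it sends \<open>(x, Y + A Y h' x)\<close> to
  \<open>(x + A' Y h x, Y)\<close>. As a quotient of two shears with the common Jacobian \<open>1 + A' Y h' x\<close> it preserves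
  area, and it is \<open>C\<^sup>k\<close> since only \<open>h'\<close> enters. Positivity of the Jacobian requires \<open>A'\<close> to be
  nearly nonnegative and at most about \<open>1\<close>, although \<open>A'\<close> has mean zero on \<open>[0, 1]\<close>.
\<close>

section \<open>Calculus of \<open>C\<^sup>k\<close> maps\<close>

text \<open>By uniqueness of the Frechet derivative any explicit formula \<open>f'\<close> may stand
  in for it, so the product, chain and quotient rules can be used directly.\<close>

lemma Ck_map_SucI:
  assumes "\<And>x. (f has_derivative f' x) (at x)" and "\<And>v. Ck_map n (\<lambda>x. f' x v)"
  shows "Ck_map (Suc n) f"
proof -
  have "frechet_derivative f (at x) = f' x" for x
    using frechet_derivative_at[OF assms(1)] by simp
  then show ?thesis
    using assms by (auto simp: differentiable_def)
qed

lemma Ck_map_has_derivative: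
  assumes "Ck_map (Suc n) f"
  shows "(f has_derivative frechet_derivative f (at x)) (at x)"
  using assms by (simp add: frechet_derivative_works)

lemma Ck_map_frechet_derivative: "Ck_map (Suc n) f \<Longrightarrow> Ck_map n (\<lambda>x. frechet_derivative f (at x) v)"
  by (simp only: Ck_map.simps)

lemma Ck_map_Suc_imp: "Ck_map (Suc n) f \<Longrightarrow> Ck_map n f"
proof (induction n arbitrary: f)
  case 0
  then show ?case
    by (simp add: continuous_at_imp_continuous_on differentiable_imp_continuous_within)
qed auto

lemma Ck_map_continuous: "Ck_map n f \<Longrightarrow> continuous_on UNIV f"
proof (induction n)
  case (Suc n)
  show ?case by (rule Suc.IH[OF Ck_map_Suc_imp[OF Suc.prems]])
qed simp

lemma Ck_map_const: "Ck_map n (\<lambda>x. c)"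
proof (induction n arbitrary: c)
  case (Suc n)
  show ?case
    by (rule Ck_map_SucI[where f' = "\<lambda>x v. 0"]) (auto simp: Suc)
qed simp

lemma Ck_map_bounded_linear:
  assumes "bounded_linear f"
  shows "Ck_map n f"
proof (cases n)
  case 0
  then show ?thesis using linear_continuous_on[OF assms] by simp
next
  case (Suc m)
  show ?thesis unfolding Suc
    by (rule Ck_map_SucI[where f' = "\<lambda>x. f"])
      (auto simp: Ck_map_const bounded_linear_imp_has_derivative[OF assms])
qed

lemma Ck_map_add:
  "Ck_map n f \<Longrightarrow> Ck_map n g \<Longrightarrow> Ck_map n (\<lambda>x. f x + g x)"
proof (induction n arbitrary: f g)
  case 0
  then show ?case by (simp add: continuous_on_add)
next
  case (Suc n)
  show ?case
    by (rule Ck_map_SucI[OF has_derivative_add[OF Suc.prems[THEN Ck_map_has_derivative]]])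
      (intro Suc.IH; use Suc.prems in simp)
qed

lemma Ck_map_sum:
  "(\<And>i. i \<in> I \<Longrightarrow> Ck_map n (f i)) \<Longrightarrow> Ck_map n (\<lambda>x. \<Sum>i\<in>I. f i x)"
  by (induction I rule: infinite_finite_induct) (auto simp: Ck_map_const Ck_map_add)

lemma (in bounded_bilinear) Ck_map_prod:
  "Ck_map n f \<Longrightarrow> Ck_map n g \<Longrightarrow> Ck_map n (\<lambda>x. prod (f x) (g x))"
proof (induction n arbitrary: f g)
  case 0
  then show ?case by (simp add: continuous_on)
next
  case (Suc n)
  \<comment> \<open>Each summand of the product rule keeps one undifferentiated factor, which is
    needed only at order \<open>n\<close>.\<close>
  note low = Suc.prems[THEN Ck_map_Suc_imp]
  show ?case
    by (rule Ck_map_SucI[OF FDERIV[OF Suc.prems[THEN Ck_map_has_derivative]]])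
      (intro Ck_map_add Suc.IH low; use Suc.prems in simp)
qed

lemmas Ck_map_mult = bounded_bilinear.Ck_map_prod[OF bounded_bilinear_mult]
lemmas Ck_map_scaleR = bounded_bilinear.Ck_map_prod[OF bounded_bilinear_scaleR]
lemmas Ck_map_inner = bounded_bilinear.Ck_map_prod[OF bounded_bilinear_inner]

text \<open>In the chain rule the derivative of \<open>f\<close> is evaluated in the direction
  \<open>G x v\<close>, which varies with \<open>x\<close>, whereas \<open>Ck_map\<close> controls
  fixed directions only. Expanding that direction in the standard basis leaves sums of products of
  C^n functions.\<close>

lemma Ck_map_compose:
  "Ck_map n f \<Longrightarrow> Ck_map n g \<Longrightarrow> Ck_map n (\<lambda>x. f (g x))"
proof (induction n arbitrary: f g)
  case 0
  then show ?case by (auto intro: continuous_on_compose2)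
next
  case (Suc n)
  define F where "F = (\<lambda>x. frechet_derivative f (at x))"
  define G where "G = (\<lambda>x. frechet_derivative g (at x))"
  have F: "(f has_derivative F x) (at x)" for x
    unfolding F_def by (rule Ck_map_has_derivative[OF Suc.prems(1)])
  have G: "(g has_derivative G x) (at x)" for x
    unfolding G_def by (rule Ck_map_has_derivative[OF Suc.prems(2)])
  have eq: "F y v = (\<Sum>b\<in>Basis. (v \<bullet> b) *\<^sub>R F y b)" for y v
  proof -
    interpret F: linear "F y" using F[of y] by (rule has_derivative_linear)
    have "F y v = F y (\<Sum>b\<in>Basis. (v \<bullet> b) *\<^sub>R b)"
      by (simp only: euclidean_representation)
    then show ?thesis by (simp add: F.sum F.scale)
  qed
  show ?case
  proof (rule Ck_map_SucI)
    show "((\<lambda>x. f (g x)) has_derivative (\<lambda>v. \<Sum>b\<in>Basis. (G x v \<bullet> b) *\<^sub>R F (g x) b)) (at x)" for x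
      using has_derivative_compose[OF G F, of x] by (subst (asm) eq)
    have "Ck_map n (\<lambda>y. F y b)" "Ck_map n (\<lambda>x. G x v)" for b v
      using Suc.prems by (simp_all add: F_def G_def)
    then show "Ck_map n (\<lambda>x. \<Sum>b\<in>Basis. (G x v \<bullet> b) *\<^sub>R F (g x) b)" for v
      by (intro Ck_map_sum Ck_map_scaleR Ck_map_inner Ck_map_const Suc.IH[of "\<lambda>y. F y b" for b]
          Ck_map_Suc_imp[OF Suc.prems(2)])
  qed
qed

lemma Ck_map_Pair:
  assumes "Ck_map n f" "Ck_map n g"
  shows "Ck_map n (\<lambda>x. (f x, g x))"
  using assms
proof (induction n arbitrary: f g)
  case 0
  then show ?case by (simp add: continuous_on_Pair)
next
  case (Suc n)
  show ?case
    by (rule Ck_map_SucI[OF has_derivative_Pair[OF Suc.prems[THEN Ck_map_has_derivative]]])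
      (intro Suc.IH; use Suc.prems in simp)
qed

lemma Ck_map_id: "Ck_map n (\<lambda>x. x)"
  by (rule Ck_map_bounded_linear) (rule bounded_linear_ident)

lemma Ck_map_compose_bounded_linear:
  assumes "bounded_linear h"
  shows "Ck_map n f \<Longrightarrow> Ck_map n (\<lambda>x. h (f x))"
proof (induction n arbitrary: f)
  case 0
  then show ?case by (simp add: bounded_linear.continuous_on[OF assms])
next
  case (Suc n)
  show ?case
    by (rule Ck_map_SucI[OF bounded_linear.has_derivative[OF assms Ck_map_has_derivative[OF Suc.prems]]])
      (intro Suc.IH; use Suc.prems in simp)
qed

lemmas Ck_map_fst = Ck_map_compose_bounded_linear[OF bounded_linear_fst]
lemmas Ck_map_snd = Ck_map_compose_bounded_linear[OF bounded_linear_snd]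

lemma Ck_map_uminus: "Ck_map n f \<Longrightarrow> Ck_map n (\<lambda>x. - f x)"
  by (rule Ck_map_compose_bounded_linear[OF bounded_linear_minus[OF bounded_linear_ident]])

lemma Ck_map_diff:
  assumes "Ck_map n f" "Ck_map n g"
  shows "Ck_map n (\<lambda>x. f x - g x)"
  unfolding diff_conv_add_uminus by (intro Ck_map_add Ck_map_uminus assms)

lemma Ck_map_power:
  fixes f :: "'a::euclidean_space \<Rightarrow> real"
  assumes "Ck_map n f"
  shows "Ck_map n (\<lambda>x. f x ^ m)"
proof (induction m)
  case 0
  show ?case unfolding power_0 by (rule Ck_map_const)
next
  case (Suc m)
  show ?case unfolding power_Suc by (rule Ck_map_mult[OF assms Suc.IH])
qed

lemma Ck_map_inverse:
  fixes f :: "'a::euclidean_space \<Rightarrow> real"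
  assumes "Ck_map n f" "\<And>x. f x \<noteq> 0"
  shows "Ck_map n (\<lambda>x. inverse (f x))"
  using assms
proof (induction n arbitrary: f)
  case 0
  then show ?case by (simp add: continuous_on_inverse del: inverse_eq_divide)
next
  case (Suc n)
  note low = Suc.IH[OF Ck_map_Suc_imp[OF Suc.prems(1)] Suc.prems(2)]
  have "Ck_map n (\<lambda>x. frechet_derivative f (at x) v)" for v
    using Suc.prems(1) by simp
  then show ?case
    by (intro Ck_map_SucI[OF Deriv.has_derivative_inverse[OF Suc.prems(2) Ck_map_has_derivative[OF Suc.prems(1)]]]
          Ck_map_uminus Ck_map_mult low)
qed

lemma Ck_map_divide:
  fixes f g :: "'a::euclidean_space \<Rightarrow> real"
  assumes "Ck_map n f" "Ck_map n g" "\<And>x. g x \<noteq> 0"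
  shows "Ck_map n (\<lambda>x. f x / g x)"
  unfolding divide_inverse by (intro Ck_map_mult Ck_map_inverse assms)

lemmas Ck_map_intros = Ck_map_const Ck_map_id Ck_map_add Ck_map_diff Ck_map_uminus Ck_map_mult
  Ck_map_power Ck_map_divide Ck_map_Pair Ck_map_fst Ck_map_snd

section \<open>C^k functions of one real variable\<close>

lemma Ck_map_real_SucI:
  fixes f :: "real \<Rightarrow> real"
  assumes "\<And>x. (f has_real_derivative f' x) (at x)" "Ck_map n f'"
  shows "Ck_map (Suc n) f"
  by (rule Ck_map_SucI[OF assms(1)[unfolded has_field_derivative_def]])
    (intro Ck_map_mult assms(2) Ck_map_const)

text \<open>A linear map of the line is multiplication by its value at 1, which identifies
  \<open>deriv f\<close> with the directional derivative in direction 1.\<close>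

lemma Ck_map_real_SucD:
  fixes f :: "real \<Rightarrow> real"
  assumes "Ck_map (Suc n) f"
  shows "(f has_real_derivative deriv f x) (at x)" "Ck_map n (deriv f)"
proof -
  have *: "(f has_real_derivative frechet_derivative f (at x) 1) (at x)" for x
  proof -
    have f: "(f has_derivative frechet_derivative f (at x)) (at x)"
      by (rule Ck_map_has_derivative[OF assms])
    interpret linear "frechet_derivative f (at x)"
      using f by (rule has_derivative_linear)
    have "frechet_derivative f (at x) = (\<lambda>v. frechet_derivative f (at x) 1 * v)"
    proof
      show "frechet_derivative f (at x) v = frechet_derivative f (at x) 1 * v" for v
        using scale[of v 1] by (simp add: mult.commute)
    qed
    with f show ?thesis
      unfolding has_field_derivative_def by (rule subst[rotated])
  qed
  then have eq: "deriv f = (\<lambda>x. frechet_derivative f (at x) 1)"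
    using DERIV_imp_deriv by blast
  show "(f has_real_derivative deriv f x) (at x)"
    unfolding eq by (rule *)
  show "Ck_map n (deriv f)"
    unfolding eq using assms by simp
qed

section \<open>Shears and area\<close>

text \<open>The vertical derivative \<open>j\<close> plays the role of the Jacobian of
  \<open>shear_map\<close>. Only continuity of \<open>u\<close> and \<open>j\<close> is assumed, so
  that the area results cover k = 0 as well. The uniform bound \<open>c\<close> makes
  \<open>u\<close> run through all reals on each vertical line.\<close>

locale shear =
  fixes u j :: "real \<times> real \<Rightarrow> real" and c :: real
  assumes deriv: "((\<lambda>y. u (x, y)) has_real_derivative j (x, y)) (at y)"
    and cont: "continuous_on UNIV u" "continuous_on UNIV j"
    and c_pos: "0 < c" and c_le: "c \<le> j p"
begin

definition shear_map :: "real \<times> real \<Rightarrow> real \<times> real" where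
  "shear_map p = (fst p, u p)"

lemma j_pos: "0 < j p"
  using c_pos c_le[of p] by linarith

text \<open>The function \<open>u (x, y) - c * y\<close> is nondecreasing in \<open>y\<close>. This
  linear rate yields both injectivity and surjectivity on vertical lines.\<close>

lemma growth:
  assumes "y \<le> y'"
  shows "u (x, y) + c * (y' - y) \<le> u (x, y')"
proof -
  have "u (x, y) - c * y \<le> u (x, y') - c * y'"
  proof (rule DERIV_nonneg_imp_nondecreasing[OF assms])
    fix z
    have "((\<lambda>y. u (x, y) - c * y) has_real_derivative j (x, z) - c) (at z)"
      by (auto intro!: derivative_eq_intros deriv)
    then show "\<exists>d. ((\<lambda>y. u (x, y) - c * y) has_real_derivative d) (at z) \<and> 0 \<le> d"
      using c_le[of "(x, z)"] by auto
  qed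
  then show ?thesis by (simp add: algebra_simps)
qed

lemma u_strict_mono: "y < y' \<Longrightarrow> u (x, y) < u (x, y')"
  using growth[of y y' x] c_pos mult_pos_pos[of c "y' - y"] by linarith

lemma less_iff: "u (x, y) < u (x, y') \<longleftrightarrow> y < y'"
  using u_strict_mono[of y y' x] u_strict_mono[of y' y x] by (cases y y' rule: linorder_cases) auto

lemma ex_solution: "\<exists>y. u (x, y) = t"
proof -
  \<comment> \<open>By \<open>growth\<close>, moving from height 0 by \<open>b\<close> changes
    \<open>u\<close> by at least the distance from \<open>u (x, 0)\<close> to \<open>t\<close>, so
    the values at \<open>-b\<close> and \<open>b\<close> bracket \<open>t\<close>.\<close>
  define b where "b = \<bar>t - u (x, 0)\<bar> / c"
  have b: "0 \<le> b" "c * b = \<bar>t - u (x, 0)\<bar>"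
    using c_pos by (auto simp: b_def)
  have "u (x, - b) \<le> t" "t \<le> u (x, b)"
    using growth[of "-b" 0 x] growth[of 0 b x] b by simp_all
  moreover have "continuous_on {-b..b} (\<lambda>y. u (x, y))"
    by (intro continuous_on_compose2[OF cont(1)] continuous_intros) auto
  ultimately show ?thesis
    using IVT'[of "\<lambda>y. u (x, y)" "-b" t b] b(1) by auto
qed

lemma bij_shear_map: "bij shear_map"
proof (rule bijI)
  show "inj shear_map"
  proof (rule injI)
    fix p q assume eq: "shear_map p = shear_map q"
    obtain x y x' y' where pq: "p = (x, y)" "q = (x', y')" by (cases p, cases q)
    have "x = x'" "u (x, y) = u (x, y')"
      using eq unfolding pq shear_map_def by auto
    then show "p = q"
      using less_iff[of x y y'] less_iff[of x y' y] unfolding pq by simp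
  qed
  show "surj shear_map"
    unfolding surj_def
  proof
    fix q :: "real \<times> real"
    obtain y where "u (fst q, y) = snd q" using ex_solution by blast
    then show "\<exists>p. q = shear_map p"
      by (intro exI[of _ "(fst q, y)"]) (simp add: shear_map_def)
  qed
qed

lemma shear_map_inv: "shear_map (inv shear_map q) = q"
  using bij_shear_map by (simp add: bij_is_surj surj_f_inv_f)

lemma continuous_shear_map: "continuous_on UNIV shear_map"
  unfolding shear_map_def[abs_def] by (intro continuous_intros cont)

text \<open>Invariance of domain: a continuous injection of the plane into itself has a continuous
  inverse.\<close>

lemma continuous_inv_shear_map: "continuous_on UNIV (inv shear_map)"
  using continuous_on_inverse_open[OF open_UNIV continuous_shear_map, of "inv shear_map"]
    bij_shear_map by (auto simp: bij_def)

text \<open>The derivative of the inverse is a rational expression in the derivative of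
  \<open>u\<close> evaluated along the inverse itself. If the inverse is C^n, so is that expression,
  which raises the order by one.\<close>

lemma Ck_inv_shear_map: "Ck_map n u \<Longrightarrow> Ck_map n (inv shear_map)"
proof (induction n)
  case 0
  show ?case using continuous_inv_shear_map by simp
next
  case (Suc n)
  define D where "D = (\<lambda>p. frechet_derivative u (at p))"
  note IH = Suc.IH[OF Ck_map_Suc_imp[OF Suc.prems]]
  have D: "(u has_derivative D p) (at p)" for p
    unfolding D_def by (rule Ck_map_has_derivative[OF Suc.prems])
  have D_Ck: "Ck_map n (\<lambda>q. D (inv shear_map q) v)" for v
    unfolding D_def
    by (rule Ck_map_compose[OF Ck_map_frechet_derivative[OF Suc.prems] IH])
  have D_lin: "D p (a, b) = D p (a, 0) + b * D p (0, 1)" for p a b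
  proof -
    interpret linear "D p" using D by (rule has_derivative_linear)
    have "(a, b) = (a, 0) + b *\<^sub>R (0, 1)" by simp
    then have "D p (a, b) = D p ((a, 0) + b *\<^sub>R (0, 1))" by (rule arg_cong)
    then show ?thesis unfolding add scale real_scaleR_def .
  qed
  \<comment> \<open>Identifying \<open>j\<close> with the vertical partial derivative makes the
    denominator in \<open>g'\<close> positive.\<close>
  have j_eq: "j p = D p (0, 1)" for p
  proof -
    have "((\<lambda>y. (fst p, y)) has_derivative (\<lambda>h. (0, h))) (at (snd p))"
      by (intro derivative_intros)
    moreover have "(u has_derivative D p) (at (fst p, snd p))"
      using D by simp
    ultimately have "((\<lambda>y. u (fst p, y)) has_derivative (\<lambda>h. D p (0, h))) (at (snd p))"
      by (rule has_derivative_compose)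
    moreover have "((\<lambda>y. u (fst p, y)) has_derivative (*) (j p)) (at (snd p))"
      using deriv[of "fst p" "snd p"] by (simp add: has_field_derivative_def)
    ultimately have "(\<lambda>h. D p (0, h)) = (*) (j p)"
      by (rule has_derivative_unique)
    from fun_cong[OF this, of 1] show ?thesis by simp
  qed
  \<comment> \<open>The derivative of \<open>shear_map\<close> is triangular, \<open>(a, b)\<close>
    going to \<open>(a, D (a, b))\<close>; \<open>g'\<close> solves this system for
    \<open>b\<close>.\<close>
  define g' where "g' = (\<lambda>q v. (fst v, (snd v - D (inv shear_map q) (fst v, 0)) / D (inv shear_map q) (0, 1)))"
  show ?case
  proof (rule Ck_map_SucI)
    fix q
    let ?p = "inv shear_map q"
    have nz: "D ?p (0, 1) \<noteq> 0"
      using j_pos[of ?p] by (simp add: j_eq)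
    interpret linear "D ?p" using D by (rule has_derivative_linear)
    have "bounded_linear (D ?p)" using D by (rule has_derivative_bounded_linear)
    show "(inv shear_map has_derivative g' q) (at q)"
    proof (rule has_derivative_inverse_basic[where f = shear_map and T = UNIV])
      show "(shear_map has_derivative (\<lambda>v. (fst v, D ?p v))) (at ?p)"
        unfolding shear_map_def[abs_def] by (intro derivative_intros D)
      show "bounded_linear (g' q)"
        unfolding g'_def divide_inverse
        by (intro bounded_linear_Pair bounded_linear_fst bounded_linear_snd bounded_linear_zero
            bounded_linear_mult_const bounded_linear_sub
            bounded_linear_compose[OF \<open>bounded_linear (D ?p)\<close>])
      have "g' q (a, D ?p (a, b)) = (a, b)" for a b
        using nz by (simp add: g'_def D_lin[of ?p a b])
      then show "g' q \<circ> (\<lambda>v. (fst v, D ?p v)) = id"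
        by (auto simp: fun_eq_iff)
      show "continuous (at q) (inv shear_map)"
        using continuous_inv_shear_map continuous_on_eq_continuous_at[OF open_UNIV] by blast
    qed (use shear_map_inv in auto)
  next
    fix v
    have "D (inv shear_map q) (0, 1) \<noteq> 0" for q
      unfolding j_eq[symmetric] using j_pos[of "inv shear_map q"] by linarith
    then show "Ck_map n (\<lambda>q. g' q v)"
      unfolding g'_def by (intro Ck_map_intros D_Ck)
  qed
qed

lemma Ck_diffeo_shear_map:
  assumes "Ck_map n u"
  shows "Ck_diffeo n shear_map"
  unfolding Ck_diffeo_def
  using bij_shear_map Ck_inv_shear_map[OF assms]
    Ck_map_Pair[OF Ck_map_fst[OF Ck_map_id] assms] by (simp add: shear_map_def[abs_def])

text \<open>Change of variables on one vertical line: the set is an interval by monotonicity, and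
  the fundamental theorem integrates \<open>j\<close> to the increment of \<open>u\<close>. The open
  interval is first closed up, its endpoints being null.\<close>

lemma nn_integral_slice:
  assumes "a \<le> b"
  shows "(\<integral>\<^sup>+y. ennreal (j (x, y)) * indicator {y. a < u (x, y) \<and> u (x, y) < b} y \<partial>lborel) = ennreal (b - a)"
proof -
  obtain y1 y2 where y: "u (x, y1) = a" "u (x, y2) = b"
    using ex_solution by metis
  then have le: "y1 \<le> y2"
    using assms less_iff[of x y2 y1] by linarith
  have set_eq: "{y. a < u (x, y) \<and> u (x, y) < b} = {y1<..<y2}"
    using y less_iff by auto
  have "(\<integral>\<^sup>+y. ennreal (j (x, y)) * indicator {y1<..<y2} y \<partial>lborel)
      = (\<integral>\<^sup>+y. ennreal (j (x, y)) * indicator {y1..y2} y \<partial>lborel)"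
    by (intro nn_integral_cong_AE, use AE_lborel_singleton[of y1] AE_lborel_singleton[of y2] in eventually_elim)
      (auto simp: indicator_def)
  also have "\<dots> = ennreal (u (x, y2) - u (x, y1))"
  proof (rule nn_integral_FTC_Icc[OF _ _ _ le])
    have "continuous_on UNIV (\<lambda>y. j (x, y))"
      by (intro continuous_on_compose2[OF cont(2)] continuous_intros) auto
    then show "(\<lambda>y. j (x, y)) \<in> borel_measurable borel"
      by (rule borel_measurable_continuous_onI)
  qed (auto intro: deriv less_imp_le[OF j_pos])
  finally show ?thesis by (simp add: set_eq y)
qed

text \<open>Lebesgue measure is determined by its values on boxes. Tonelli reduces the preimage of a
  box to its vertical slices, each with weighted length equal to the height of the box.\<close>

lemma distr_shear_map: "distr (density lborel (\<lambda>p. ennreal (j p))) borel shear_map = lborel"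
proof (rule lborel_eqI[symmetric])
  fix l r :: "real \<times> real"
  assume le: "\<And>b. b \<in> Basis \<Longrightarrow> l \<bullet> b \<le> r \<bullet> b"
  obtain l1 l2 r1 r2 where lr: "l = (l1, l2)" "r = (r1, r2)" by (cases l, cases r)
  have le': "l1 \<le> r1" "l2 \<le> r2"
    using le[of "(1, 0)"] le[of "(0, 1)"] by (auto simp: lr Basis_prod_def)
  have [measurable]: "shear_map \<in> borel_measurable borel" "j \<in> borel_measurable borel"
    "u \<in> borel_measurable borel"
    using continuous_shear_map cont by (auto intro: borel_measurable_continuous_onI)
  let ?f = "\<lambda>p. ennreal (j p) * indicator (shear_map -` box l r) p"
  have [measurable]: "shear_map -` box l r \<in> sets borel"
    using measurable_sets_borel[of shear_map borel] by simp
  have fm: "?f \<in> borel_measurable borel" by measurable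
  have "emeasure (distr (density lborel (\<lambda>p. ennreal (j p))) borel shear_map) (box l r)
      = (\<integral>\<^sup>+p. ?f p \<partial>lborel)"
    by (simp add: emeasure_distr emeasure_density)
  also have "\<dots> = (\<integral>\<^sup>+x. \<integral>\<^sup>+y. ?f (x, y) \<partial>lborel \<partial>lborel)"
    using lborel.nn_integral_fst[of ?f lborel] fm by (simp add: lborel_prod)
  also have "\<dots> = (\<integral>\<^sup>+x. ennreal (r2 - l2) * indicator {l1<..<r1} x \<partial>lborel)"
  proof (rule nn_integral_cong)
    fix x
    have "?f (x, y) = ennreal (j (x, y)) * indicator {y. l2 < u (x, y) \<and> u (x, y) < r2} y
        * indicator {l1<..<r1} x" for y
      by (auto simp: indicator_def lr box_prod shear_map_def)
    then show "(\<integral>\<^sup>+y. ?f (x, y) \<partial>lborel) = ennreal (r2 - l2) * indicator {l1<..<r1} x"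
      using nn_integral_slice[OF le'(2), of x] by (auto simp: indicator_def)
  qed
  also have "\<dots> = ennreal (r2 - l2) * ennreal (r1 - l1)"
    using le' by (simp add: nn_integral_cmult_indicator)
  also have "\<dots> = ennreal (\<Prod>b\<in>Basis. (r - l) \<bullet> b)"
    using le' by (simp add: lr Basis_prod_def ennreal_mult' mult.commute)
  finally show "emeasure (distr (density lborel (\<lambda>p. ennreal (j p))) borel shear_map) (box l r)
      = ennreal (\<Prod>b\<in>Basis. (r - l) \<bullet> b)" .
qed simp

end

section \<open>Composition, inversion and transport of area\<close>

lemma Ck_diffeo_comp:
  assumes "Ck_diffeo n f" "Ck_diffeo n g"
  shows "Ck_diffeo n (f \<circ> g)"
proof -
  have "inv (f \<circ> g) = inv g \<circ> inv f"
    using assms by (simp add: Ck_diffeo_def o_inv_distrib)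
  moreover have "Ck_map n (f \<circ> g)" "Ck_map n (inv g \<circ> inv f)"
    unfolding o_def using assms Ck_map_compose by (auto simp only: Ck_diffeo_def)
  ultimately show ?thesis
    using assms by (simp add: Ck_diffeo_def bij_comp)
qed

lemma Ck_diffeo_inv: "Ck_diffeo n f \<Longrightarrow> Ck_diffeo n (inv f)"
  by (simp add: Ck_diffeo_def bij_imp_bij_inv inv_inv_eq)

lemma Ck_diffeo_swap: "Ck_diffeo n (prod.swap :: real \<times> real \<Rightarrow> _)"
proof -
  have "inv prod.swap = (prod.swap :: real \<times> real \<Rightarrow> _)"
    by (rule inv_equality) auto
  moreover have "Ck_map n (prod.swap :: real \<times> real \<Rightarrow> _)"
    unfolding prod.swap_def[abs_def] by (intro Ck_map_intros)
  ultimately show ?thesis by (simp add: Ck_diffeo_def)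
qed

lemma Ck_diffeo_measurable: "Ck_diffeo n f \<Longrightarrow> f \<in> borel_measurable borel"
  unfolding Ck_diffeo_def by (blast intro: borel_measurable_continuous_onI Ck_map_continuous)

lemma distr_lborel_swap:
  "distr lborel borel prod.swap = (lborel :: (real \<times> real) measure)"
proof -
  have "(lborel :: (real \<times> real) measure)
      = distr (lborel \<Otimes>\<^sub>M lborel) (lborel \<Otimes>\<^sub>M lborel) (\<lambda>(x, y). (y, x))"
    using lborel_pair.distr_pair_swap by (simp add: lborel_prod)
  also have "\<dots> = distr lborel borel prod.swap"
    by (intro distr_cong) (simp_all only: lborel_prod sets_lborel prod.swap_def case_prod_beta)
  finally show ?thesis ..
qed

text \<open>The hypothesis speaks of Borel sets. As the image measure is again
  \<open>lborel\<close>, null sets pull back to null sets, so measurability and the measure identity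
  pass to the completion.\<close>

lemma area_preservingI:
  assumes [measurable]: "f \<in> borel_measurable borel" and "distr lborel borel f = lborel"
  shows "area_preserving f"
proof -
  have fl: "f \<in> lebesgue \<rightarrow>\<^sub>M lborel"
    by (intro measurable_completion) simp
  have eq: "distr lebesgue lborel f = lborel"
    using assms by (subst distr_completion) (auto cong: distr_cong)
  have "completion (distr lebesgue lborel f) = distr lebesgue lebesgue f"
    by (rule completion.completion_distr_eq[OF fl]) (simp add: eq)
  then have d: "distr lebesgue lebesgue f = lebesgue" by (simp add: eq)
  have m: "f \<in> lebesgue \<rightarrow>\<^sub>M lebesgue"
    by (rule completion.measurable_completion2[OF fl]) (simp add: eq)
  show ?thesis
    unfolding area_preserving_def
  proof (intro conjI m ballI)
    fix A :: "(real \<times> real) set" assume "A \<in> sets lebesgue"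
    then show "emeasure lebesgue (f -` A) = emeasure lebesgue A"
      using emeasure_distr[OF m, of A] d by simp
  qed
qed

lemma area_preserving_comp:
  assumes "area_preserving f" "area_preserving g"
  shows "area_preserving (f \<circ> g)"
proof -
  have "f -` A \<in> sets lebesgue" if "A \<in> sets lebesgue" for A
    using measurable_sets[of f lebesgue lebesgue A] assms(1) that by (simp add: area_preserving_def)
  with assms show ?thesis
    unfolding area_preserving_def vimage_comp[symmetric] using measurable_comp by metis
qed

lemma area_preserving_swap: "area_preserving prod.swap"
  by (intro area_preservingI distr_lborel_swap borel_measurable_continuous_onI continuous_on_swap)

text \<open>Writing Lebesgue measure as the image of \<open>M\<close> under \<open>P\<close>, the
  factor \<open>inv P\<close> cancels and the image under \<open>Q\<close> remains. This applies to
  two shears that push the same weighted measure to Lebesgue measure.\<close>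

lemma area_preserving_transport:
  assumes "Ck_diffeo n P" and [measurable]: "Q \<in> borel_measurable borel"
    and M: "sets M = sets borel" and "distr M borel P = lborel" "distr M borel Q = lborel"
  shows "area_preserving (Q \<circ> inv P)"
proof (rule area_preservingI)
  have [measurable]: "P \<in> borel_measurable borel" "inv P \<in> borel_measurable borel"
    using assms(1) Ck_diffeo_inv Ck_diffeo_measurable by blast+
  show "Q \<circ> inv P \<in> borel_measurable borel" by measurable
  have "distr lborel borel (Q \<circ> inv P) = distr (distr M borel P) borel (Q \<circ> inv P)"
    by (simp add: assms)
  also have "\<dots> = distr M borel (Q \<circ> inv P \<circ> P)"
    by (intro distr_distr) (auto simp: measurable_cong_sets[OF M refl])
  also have "Q \<circ> inv P \<circ> P = Q"
    using assms(1) by (auto simp: fun_eq_iff Ck_diffeo_def bij_def)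
  finally show "distr lborel borel (Q \<circ> inv P) = lborel"
    by (simp only: assms)
qed

section \<open>Extension of an interval diffeomorphism to the line\<close>

text \<open>Supplies a C^n cutoff vanishing on a half-line. Differentiation gives a multiple of the
  next lower power, hence the induction.\<close>

lemma Ck_map_max_power: "Ck_map n (\<lambda>x::real. max 0 x ^ Suc n)"
proof (induction n)
  case 0
  show ?case by (auto intro!: continuous_intros)
next
  case (Suc n)
  have "((\<lambda>x::real. max 0 x ^ Suc (Suc n)) has_real_derivative real (Suc (Suc n)) * max 0 x ^ Suc n) (at x)" for x
  proof (cases x "0::real" rule: linorder_cases)
    case less
    have "((\<lambda>x::real. 0) has_real_derivative real (Suc (Suc n)) * max 0 x ^ Suc n) (at x)"
      using less by simp
    then show ?thesis
      by (rule has_field_derivative_transform_within_open[of _ _ _ "{..<0}"]) (use less in auto)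
  next
    case greater
    have "((\<lambda>x::real. x ^ Suc (Suc n)) has_real_derivative real (Suc (Suc n)) * max 0 x ^ Suc n) (at x)"
      by (rule derivative_eq_intros refl)+ (use greater in simp)
    then show ?thesis
      by (rule has_field_derivative_transform_within_open[of _ _ _ "{0<..}"]) (use greater in auto)
  next
    case equal
    \<comment> \<open>Caratheodory's criterion at 0: the difference quotient is itself a continuous
      function vanishing there.\<close>
    have "\<forall>z::real. max 0 z ^ Suc (Suc n) - max 0 0 ^ Suc (Suc n) = max 0 z ^ Suc n * (z - 0)"
      by (auto simp: max_def)
    moreover have "isCont (\<lambda>z::real. max 0 z ^ Suc n) 0"
      by (intro continuous_intros)
    ultimately show ?thesis
      unfolding equal CARAT_DERIV by (intro exI[of _ "\<lambda>z. max 0 z ^ Suc n"]) simp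
  qed
  then show ?case
    by (rule Ck_map_real_SucI) (intro Ck_map_mult Ck_map_const Suc.IH)
qed

lemma Ck_map_sin_cos: "Ck_map n (sin :: real \<Rightarrow> real) \<and> Ck_map n (cos :: real \<Rightarrow> real)"
proof (induction n)
  case 0
  show ?case by (simp add: continuous_on_sin continuous_on_cos continuous_on_id)
next
  case (Suc n)
  then show ?case
    using Ck_map_real_SucI[OF DERIV_sin] Ck_map_real_SucI[OF DERIV_cos]
      Ck_map_uminus[of n "sin :: real \<Rightarrow> real"] by blast
qed

lemma Ck_map_arctan: "Ck_map n arctan"
proof (rule Ck_map_Suc_imp, rule Ck_map_real_SucI)
  show "(arctan has_real_derivative inverse (1 + x\<^sup>2)) (at x)" for x
    by (rule DERIV_arctan)
  show "Ck_map n (\<lambda>x::real. inverse (1 + x\<^sup>2))"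
    by (intro Ck_map_inverse Ck_map_intros) (simp add: add_pos_nonneg less_imp_neq[symmetric])
qed

text \<open>Damping \<open>w\<close> outside \<open>[0, 1]\<close> by \<open>1 + p (1 + w\<^sup>2)\<close> keeps it away from \<open>-1\<close>: near the interval \<open>w\<close> is
  small, and elsewhere \<open>p \<ge> 1\<close>.\<close>

lemma bounded_extension:
  fixes w :: "real \<Rightarrow> real"
  assumes w: "Ck_map k w" "w 0 = 0" "w 1 = 0" and gt: "\<And>x. x \<in> {0..1} \<Longrightarrow> - 1 < w x"
  obtains W q M where "Ck_map k W" "\<And>x. x \<in> {0..1} \<Longrightarrow> W x = w x"
    "0 < q" "q \<le> 1" "1 \<le> M" "\<And>x. q - 1 \<le> W x" "\<And>x. W x \<le> M"
proof -
  have cont: "continuous_on UNIV w" using w(1) by (rule Ck_map_continuous)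
  have small: "\<exists>d>0. \<forall>x. \<bar>x - a\<bar> < d \<longrightarrow> \<bar>w x\<bar> < 1 / 2" if "w a = 0" for a
  proof -
    obtain d where "0 < d" "\<And>x. dist x a < d \<Longrightarrow> dist (w x) (w a) < 1 / 2"
      using cont half_gt_zero[OF zero_less_one] unfolding continuous_on_iff by blast
    with that show ?thesis by (auto simp: dist_real_def)
  qed
  obtain d0 d1 where d01: "0 < d0" "0 < d1" "\<And>x. \<bar>x\<bar> < d0 \<Longrightarrow> \<bar>w x\<bar> < 1 / 2"
    "\<And>x. \<bar>x - 1\<bar> < d1 \<Longrightarrow> \<bar>w x\<bar> < 1 / 2"
    using small[OF w(2)] small[OF w(3)] by auto
  define d where "d = min d0 d1"
  have d_pos: "0 < d" using d01 by (simp add: d_def)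
  have near: "\<bar>w x\<bar> < 1 / 2" if "x \<notin> {0..1}" "- d < x" "x < 1 + d" for x
  proof -
    have "\<bar>x\<bar> < d0 \<or> \<bar>x - 1\<bar> < d1"
      using that unfolding d_def by auto
    then show ?thesis using d01 by blast
  qed
  \<comment> \<open>The product \<open>x * (x - 1)\<close> is positive exactly off [0, 1] and at
    least \<open>d\<close> at distance \<open>d\<close> or more from it, so the factor
    \<open>inverse d\<close> makes \<open>p\<close> at least 1 there. With exponent
    \<open>Suc k\<close> the positive part is C^k.\<close>
  define p where "p = (\<lambda>x. inverse d ^ Suc k * max 0 (x * (x - 1)) ^ Suc k)"
  define W where "W = (\<lambda>x. w x / (1 + p x * (1 + (w x)\<^sup>2)))"
  have p_nonneg: "0 \<le> p x" for x
    using d_pos by (simp add: p_def)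
  have p_zero: "p x = 0" if "x \<in> {0..1}" for x
  proof -
    have "x * (x - 1) \<le> 0" using that by (intro mult_nonneg_nonpos) auto
    then show ?thesis by (simp add: p_def max_absorb1)
  qed
  have p_ge: "1 \<le> p x" if "x \<le> - d \<or> 1 + d \<le> x" for x
  proof -
    have "d \<le> x * (x - 1)"
      using that
    proof
      assume "x \<le> - d"
      then have "d * 1 \<le> (- x) * (1 - x)" using d_pos by (intro mult_mono) auto
      then show ?thesis by (simp add: algebra_simps)
    next
      assume "1 + d \<le> x"
      then have "1 * d \<le> x * (x - 1)" using d_pos by (intro mult_mono) auto
      then show ?thesis by simp
    qed
    then have "1 \<le> inverse d * max 0 (x * (x - 1))"
      using d_pos by (simp add: field_simps)
    then have "1 \<le> (inverse d * max 0 (x * (x - 1))) ^ Suc k"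
      by (rule one_le_power)
    then show ?thesis by (simp only: p_def power_mult_distrib)
  qed
  have den: "1 \<le> 1 + p x * (1 + (w x)\<^sup>2)" for x
    using p_nonneg by simp
  have W_le: "\<bar>W x\<bar> \<le> \<bar>w x\<bar>" for x
  proof -
    have "\<bar>W x\<bar> = \<bar>w x\<bar> / (1 + p x * (1 + (w x)\<^sup>2))"
      using den[of x] by (simp add: W_def)
    also have "\<dots> \<le> \<bar>w x\<bar> / 1"
      using den[of x] by (intro divide_left_mono) auto
    finally show ?thesis by simp
  qed
  have outside: "\<bar>W x\<bar> \<le> 1 / 2" if "x \<notin> {0..1}" for x
  proof (cases "x \<le> - d \<or> 1 + d \<le> x")
    case True
    have "2 * \<bar>w x\<bar> \<le> 1 * (1 + (w x)\<^sup>2)"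
      \<comment> \<open>From \<open>(\<bar>w\<bar> - 1)^2 \<ge> 0\<close>; the damped quotient is
        therefore at most 1/2 in absolute value wherever \<open>p\<close> is at least 1.\<close>
      using zero_le_power2[of "\<bar>w x\<bar> - 1"] by (simp add: power2_diff)
    also have "\<dots> \<le> p x * (1 + (w x)\<^sup>2)"
      using p_ge[OF True] by (intro mult_right_mono) auto
    finally have "2 * \<bar>w x\<bar> \<le> 1 + p x * (1 + (w x)\<^sup>2)" by linarith
    then show ?thesis using den[of x] by (simp add: W_def field_simps)
  next
    case False
    then show ?thesis using near[OF that] W_le[of x] by linarith
  qed
  have inside: "W x = w x" if "x \<in> {0..1}" for x
    using p_zero[OF that] by (simp add: W_def)
  have cont01: "continuous_on {0..1} w"
    using cont by (rule continuous_on_subset) simp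
  obtain a where a: "a \<in> {0..1}" "\<And>x. x \<in> {0..1} \<Longrightarrow> w a \<le> w x"
    using continuous_attains_inf[OF compact_Icc _ cont01] by auto
  obtain b where b: "b \<in> {0..1}" "\<And>x. x \<in> {0..1} \<Longrightarrow> w x \<le> w b"
    using continuous_attains_sup[OF compact_Icc _ cont01] by auto
  show ?thesis
  \<comment> \<open>Off [0, 1] the values of \<open>W\<close> lie in [-1/2, 1/2]; on it they lie
    between the minimum \<open>w a\<close>, which exceeds -1, and the maximum
    \<open>w b\<close>.\<close>
  proof (rule that[of W "min (1/2) (1 + w a)" "max 1 (w b)"])
    show "Ck_map k W"
    proof -
      have "Ck_map k (\<lambda>x::real. max 0 (x * (x - 1)) ^ Suc k)"
        by (rule Ck_map_compose[OF Ck_map_max_power]) (intro Ck_map_intros)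
      then have "Ck_map k p"
        unfolding p_def by (rule Ck_map_mult[OF Ck_map_const])
      moreover have "1 + p x * (1 + (w x)\<^sup>2) \<noteq> 0" for x
        using den[of x] by linarith
      ultimately show ?thesis
        unfolding W_def by (intro Ck_map_intros w(1))
    qed
    show "min (1/2) (1 + w a) - 1 \<le> W x" for x
      using outside[of x] a(2)[of x] inside[of x] by (cases "x \<in> {0..1}") auto
    show "W x \<le> max 1 (w b)" for x
      using outside[of x] b(2)[of x] inside[of x] by (cases "x \<in> {0..1}") auto
  qed (use inside gt[OF a(1)] in auto)
qed

text \<open>Off [0, 1] the derivative of \<open>f\<close> may vanish or be unbounded, so the
  derivative is modified there and then integrated: \<open>W\<close> is a controlled extension of
  \<open>deriv f - 1\<close>, and \<open>h\<close> is its antiderivative. The end slopes 1 provide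
  the zeros that \<open>bounded_extension\<close> requires.\<close>

lemma diffeo_extension:
  assumes f: "Ck_map (Suc k) f" "f 0 = 0" "f 1 = 1" "deriv f 0 = 1" "deriv f 1 = 1"
    and pos: "\<And>x. x \<in> {0..1} \<Longrightarrow> 0 < deriv f x"
  obtains W h q M where "Ck_map k W" "\<And>x. (h has_real_derivative W x) (at x)"
    "\<And>x. x \<in> {0..1} \<Longrightarrow> x + h x = f x" "W 0 = 0" "W 1 = 0"
    "0 < q" "q \<le> 1" "1 \<le> M" "\<And>x. q - 1 \<le> W x" "\<And>x. W x \<le> M"
proof -
  have "Ck_map k (\<lambda>x. deriv f x - 1)"
    by (intro Ck_map_intros Ck_map_real_SucD(2)[OF f(1)])
  then obtain W q M where W: "Ck_map k W" "\<And>x. x \<in> {0..1} \<Longrightarrow> W x = deriv f x - 1"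
    and bounds: "0 < q" "q \<le> 1" "1 \<le> M" "\<And>x. q - 1 \<le> W x" "\<And>x. W x \<le> M"
    by (rule bounded_extension) (use f pos in auto)
  have "continuous_on UNIV W" using W(1) by (rule Ck_map_continuous)
  then have "isCont W x" for x by (simp add: continuous_on_eq_continuous_at)
  then obtain H where H: "\<And>x. (H has_real_derivative W x) (at x)"
    using einterval_antiderivative[of "-\<infinity>" "\<infinity>" W]
    by (auto simp: has_real_derivative_iff_has_vector_derivative)
  \<comment> \<open>Normalised to vanish at 0, so that the constant by which \<open>f x - x\<close>
    and \<open>h x\<close> differ on [0, 1] is zero.\<close>
  define h where "h = (\<lambda>x. H x - H 0)"
  have h: "(h has_real_derivative W x) (at x)" for x
    unfolding h_def by (auto intro!: derivative_eq_intros H)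
  have "\<exists>d. \<forall>x\<in>{0..1}. f x - x - h x = d"
  proof (rule has_field_derivative_zero_constant)
    fix y :: real assume y: "y \<in> {0..1}"
    have "((\<lambda>x. f x - x - h x) has_real_derivative deriv f y - 1 - W y) (at y within {0..1})"
      by (intro derivative_intros Ck_map_real_SucD(1)[OF f(1), THEN DERIV_subset] h[THEN DERIV_subset]) auto
    then show "((\<lambda>x. f x - x - h x) has_real_derivative 0) (at y within {0..1})"
      using W(2)[OF y] by simp
  qed simp
  then obtain d where d: "\<And>x. x \<in> {0..1} \<Longrightarrow> f x - x - h x = d" by blast
  then have "d = 0" using f(2) d[of 0] by (simp add: h_def)
  then have "x + h x = f x" if "x \<in> {0..1}" for x
    using d[OF that] by simp
  then show ?thesis
    using that[OF W(1) h _ _ _ bounds] W(2)[of 0] W(2)[of 1] f by simp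
qed

text \<open>The derivative of a bump \<open>A\<close> that starts with slope \<open>1\<close> must be negative somewhere; the arctangent
  rises so quickly to the small height \<open>O(e)\<close> that the slope of the descent is \<open>O(e)\<close>.\<close>

lemma bump_of_slope_one:
  fixes c e :: real
  assumes "c \<in> {0, 1}" "0 < e"
  obtains A a where "\<And>n. Ck_map n A" "\<And>n. Ck_map n a"
    "\<And>s. (A has_real_derivative a s) (at s)" "A 0 = 0" "A 1 = 0" "a c = 1" "a (1 - c) = 0"
    "\<And>s. - e \<le> a s" "\<And>s. a s \<le> 1 + e"
proof -
  \<comment> \<open>The descent term \<open>B\<close> is at most \<open>2 * 2 * 1 / N\<close> in
    absolute value, which is \<open>e\<close>.\<close>
  define N where "N = 4 / e"
  have N: "0 < N" using assms(2) by (simp add: N_def)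
  \<comment> \<open>This factor is 1 at 0 and has double zeros at -1 and 1. Hence both
    \<open>A\<close> and its derivative vanish at \<open>1 - c\<close>, while the slope of
    \<open>A\<close> at \<open>c\<close> is that of the arctangent factor.\<close>
  define \<rho> where "\<rho> = (\<lambda>t. (1 + cos (pi * t)) / 2)"
  define B where "B = (\<lambda>t. arctan (N * t) / N * (pi / 2) * sin (pi * t))"
  define A where "A = (\<lambda>s. arctan (N * (s - c)) / N * \<rho> (s - c))"
  \<comment> \<open>The product rule for \<open>A\<close>: the first term lies in [0, 1], and only
    \<open>B\<close> can be negative or push the slope above 1.\<close>
  define a where "a = (\<lambda>s. \<rho> (s - c) / (1 + (N * (s - c))\<^sup>2) - B (s - c))"
  have den: "1 \<le> 1 + (N * (s - c))\<^sup>2" for s by simp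
  have den_ne: "1 + (N * (s - c))\<^sup>2 \<noteq> 0" for s using den[of s] by linarith
  have B: "\<bar>B t\<bar> \<le> e" for t
  proof -
    have "\<bar>arctan (N * t)\<bar> \<le> 2"
      using arctan_bounded[of "N * t"] pi_less_4 by (auto simp: abs_le_iff)
    then have "\<bar>arctan (N * t)\<bar> * (pi / 2) * \<bar>sin (pi * t)\<bar> \<le> 2 * 2 * 1"
      using pi_less_4 by (intro mult_mono) auto
    then show ?thesis
      using N assms(2) by (simp add: B_def N_def abs_mult field_simps)
  qed
  have \<rho>_ge: "0 \<le> \<rho> t" for t
  proof -
    have "0 \<le> 1 + cos (pi * t)" using cos_ge_minus_one[of "pi * t"] by linarith
    then show ?thesis by (simp add: \<rho>_def)
  qed
  have \<rho>_le: "\<rho> t \<le> 1" for t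
    by (simp add: \<rho>_def)
  show ?thesis
  proof (rule that[of A a])
    note comps = Ck_map_compose[OF Ck_map_arctan] Ck_map_compose[OF Ck_map_sin_cos[THEN conjunct1]]
      Ck_map_compose[OF Ck_map_sin_cos[THEN conjunct2]]
    show "Ck_map n A" for n
      unfolding A_def \<rho>_def using N by (intro Ck_map_intros comps) auto
    show "Ck_map n a" for n
      unfolding a_def B_def \<rho>_def by (intro Ck_map_intros comps den_ne) (use N in auto)
    show "(A has_real_derivative a s) (at s)" for s
    proof -
      have arctan_N: "((\<lambda>s. arctan (N * (s - c)) / N) has_real_derivative inverse (1 + (N * (s - c))\<^sup>2)) (at s)"
      proof -
        have "((\<lambda>s. N * (s - c)) has_real_derivative N) (at s)"
          by (rule derivative_eq_intros refl | simp)+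
        from DERIV_cdivide[OF DERIV_chain2[OF DERIV_arctan this], of N] N show ?thesis
          by simp
      qed
      have "((\<lambda>s. pi * (s - c)) has_real_derivative pi) (at s)"
        by (rule derivative_eq_intros refl | simp)+
      from DERIV_cdivide[OF DERIV_add[OF DERIV_const DERIV_chain2[OF DERIV_cos this]], of 1 2]
      have "((\<lambda>s. \<rho> (s - c)) has_real_derivative (0 + - sin (pi * (s - c)) * pi) / 2) (at s)"
        unfolding \<rho>_def .
      from DERIV_mult[OF arctan_N this]
      have "(A has_real_derivative inverse (1 + (N * (s - c))\<^sup>2) * \<rho> (s - c)
          + (0 + - sin (pi * (s - c)) * pi) / 2 * (arctan (N * (s - c)) / N)) (at s)"
        unfolding A_def .
      moreover have "inverse D * r + (0 + - S * p) / 2 * v = r / D - v * (p / 2) * S"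
        for D r S p v :: real
        unfolding divide_inverse by algebra
      ultimately show ?thesis
        unfolding a_def B_def by (rule DERIV_cong)
    qed
    show "A 0 = 0" "A 1 = 0" "a c = 1" "a (1 - c) = 0"
      using assms(1) by (auto simp: A_def a_def B_def \<rho>_def)
    fix s
    have "0 \<le> \<rho> (s - c) / (1 + (N * (s - c))\<^sup>2)"
      by (intro divide_nonneg_nonneg \<rho>_ge) simp
    moreover have "\<rho> (s - c) / (1 + (N * (s - c))\<^sup>2) \<le> 1 / 1"
      by (intro frac_le \<rho>_le den) simp_all
    ultimately show "- e \<le> a s" "a s \<le> 1 + e"
      using B[of "s - c"] by (auto simp: a_def abs_le_iff)
  qed
qed

section \<open>One side at a time\<close>

text \<open>Serves both shears of the generating function: once for \<open>A\<close> with factor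
  \<open>W\<close>, once for \<open>h\<close> with factor \<open>a\<close>.\<close>

lemma shear_product:
  assumes A: "\<And>s. (A has_real_derivative a s) (at s)"
    and "continuous_on UNIV a" "continuous_on UNIV w" "0 < q" and le: "\<And>x s. q \<le> 1 + a s * w x"
  shows "shear (\<lambda>p. snd p + A (snd p) * w (fst p)) (\<lambda>p. 1 + a (snd p) * w (fst p)) q"
proof
  have A_cont: "continuous_on UNIV A"
    using A by (intro continuous_at_imp_continuous_on) (auto intro: DERIV_isCont)
  show "((\<lambda>y. snd (x, y) + A (snd (x, y)) * w (fst (x, y))) has_real_derivative
      1 + a (snd (x, y)) * w (fst (x, y))) (at y)" for x y
    by (auto intro!: derivative_eq_intros A)
  show "continuous_on UNIV (\<lambda>p. snd p + A (snd p) * w (fst p))"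
    "continuous_on UNIV (\<lambda>p. 1 + a (snd p) * w (fst p))"
    by (intro continuous_intros continuous_on_compose2[OF A_cont] continuous_on_compose2[OF assms(2)]
        continuous_on_compose2[OF assms(3)]; simp)+
qed (use assms in auto)

lemma horizontal_side_extension:
  fixes f :: "real \<Rightarrow> real"
  assumes f: "Ck_map (Suc k) f" "f 0 = 0" "f 1 = 1" "deriv f 0 = 1" "deriv f 1 = 1"
    and pos: "\<And>x. x \<in> {0..1} \<Longrightarrow> 0 < deriv f x" and c: "c \<in> {0, 1}"
  obtains T where "Ck_diffeo k T" "area_preserving T" "\<And>t. t \<in> {0..1} \<Longrightarrow> T (t, c) = (f t, c)"
    "\<And>t. T (t, 1 - c) = (t, 1 - c)" "\<And>t. T (0, t) = (0, t)" "\<And>t. T (1, t) = (1, t)"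
proof -
  obtain W h q M where W: "Ck_map k W" and h: "\<And>x. (h has_real_derivative W x) (at x)"
    "\<And>x. x \<in> {0..1} \<Longrightarrow> x + h x = f x" and W01: "W 0 = 0" "W 1 = 0"
    and bounds: "0 < q" "q \<le> 1" "1 \<le> M" "\<And>x. q - 1 \<le> W x" "\<And>x. W x \<le> M"
    by (rule diffeo_extension[OF f]) (use pos in auto)
  \<comment> \<open>Two cases constrain \<open>e\<close>. If \<open>a > 0 > W\<close>, the Jacobian
    is at least \<open>1 - (1 + e) * (1 - q)\<close>, hence at least \<open>q - e\<close>; if
    \<open>a < 0 < W\<close>, it is at least \<open>1 - e * M\<close>.\<close>
  define e where "e = q / (2 * M)"
  have "q / (2 * M) \<le> q / (2 * 1)" "q / (2 * M) * M \<le> 1 / 2"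
    using bounds by (auto intro!: divide_left_mono simp: field_simps)
  then have e: "0 < e" "e \<le> q / 2" "e * M \<le> 1 / 2"
    using bounds by (auto simp: e_def)
  obtain A a where A: "\<And>n. Ck_map n A" "\<And>n. Ck_map n a"
    "\<And>s. (A has_real_derivative a s) (at s)" "A 0 = 0" "A 1 = 0" "a c = 1" "a (1 - c) = 0"
    "\<And>s. - e \<le> a s" "\<And>s. a s \<le> 1 + e"
    by (rule bump_of_slope_one[OF c e(1)]) blast
  have jac: "q / 2 \<le> 1 + a s * W x" for s x
  proof (cases "0 \<le> a s"; cases "0 \<le> W x")
    assume "0 \<le> a s" "0 \<le> W x"
    then have "0 \<le> a s * W x" by simp
    then show ?thesis using bounds by linarith
  next
    assume "0 \<le> a s" "\<not> 0 \<le> W x"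
    then have "a s * - W x \<le> (1 + e) * (1 - q)"
      using A(9)[of s] bounds(4)[of x] by (intro mult_mono) auto
    also have "\<dots> \<le> 1 + e - q"
      using e bounds by (simp add: algebra_simps)
    finally show ?thesis using e by simp
  next
    assume "\<not> 0 \<le> a s" "0 \<le> W x"
    then have "- a s * W x \<le> e * M"
      using A(8)[of s] bounds(5)[of x] by (intro mult_mono) auto
    then show ?thesis using e bounds by linarith
  next
    assume "\<not> 0 \<le> a s" "\<not> 0 \<le> W x"
    then have "0 \<le> a s * W x" by (intro mult_nonpos_nonpos) auto
    then show ?thesis using bounds by linarith
  qed
  define u where "u = (\<lambda>p. snd p + A (snd p) * W (fst p))"
  define j where "j = (\<lambda>p. 1 + a (snd p) * W (fst p))"
  \<comment> \<open>The second shear is horizontal, whereas the locale shears vertically;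
    \<open>u'\<close> and \<open>j'\<close> therefore take swapped coordinates, and \<open>Q\<close>
    below is conjugated by the swap.\<close>
  define u' where "u' = (\<lambda>p. snd p + h (snd p) * a (fst p))"
  define j' where "j' = (\<lambda>p. 1 + W (snd p) * a (fst p))"
  note cont = Ck_map_continuous[OF W] Ck_map_continuous[OF A(2)]
  have q: "0 < q / 2" using bounds by simp
  interpret P: shear u j "q / 2"
    unfolding u_def j_def by (rule shear_product[of A a W, OF A(3) cont(2,1) q jac])
  have jac': "q / 2 \<le> 1 + W x * a s" for s x
    using jac[of s x] by (simp add: mult.commute)
  interpret Q: shear u' j' "q / 2"
    unfolding u'_def j'_def by (rule shear_product[of h W a, OF h(1) cont q jac'])
  define Q where "Q = prod.swap \<circ> Q.shear_map \<circ> prod.swap"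
  have "Ck_map k h"
    using Ck_map_real_SucI[OF h(1) W] by (rule Ck_map_Suc_imp)
  note comps = Ck_map_compose[OF A(1)] Ck_map_compose[OF A(2)] Ck_map_compose[OF W]
    Ck_map_compose[OF this]
  have "Ck_map k u" "Ck_map k u'"
    unfolding u_def u'_def by (intro Ck_map_intros comps)+
  then have P_diffeo: "Ck_diffeo k P.shear_map" and "Ck_diffeo k Q.shear_map"
    using P.Ck_diffeo_shear_map Q.Ck_diffeo_shear_map by blast+
  then have Q_diffeo: "Ck_diffeo k Q"
    unfolding Q_def by (intro Ck_diffeo_comp Ck_diffeo_swap)
  let ?M = "density lborel (\<lambda>p. ennreal (j p))"
  have [measurable]: "(prod.swap :: real \<times> real \<Rightarrow> _) \<in> borel_measurable borel"
    "Q.shear_map \<in> borel_measurable borel" "j' \<in> borel_measurable borel"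
    using Ck_diffeo_swap Ck_diffeo_measurable Q.continuous_shear_map Q.cont(2)
    by (auto intro: borel_measurable_continuous_onI)
  \<comment> \<open>The swap carries the weight \<open>j\<close> to \<open>j'\<close>: the two
    shears share one Jacobian, so both push \<open>?M\<close> to Lebesgue measure.\<close>
  have "distr ?M borel prod.swap = density lborel (\<lambda>p. ennreal (j' p))"
  proof -
    have "density (distr lborel borel prod.swap) (\<lambda>p. ennreal (j' p))
        = distr (density lborel (\<lambda>p. ennreal (j' (prod.swap p)))) borel prod.swap"
      by (rule density_distr) simp_all
    then show ?thesis
      by (simp add: distr_lborel_swap j_def j'_def mult.commute)
  qed
  then have "distr (distr (distr ?M borel prod.swap) borel Q.shear_map) borel prod.swap = lborel"
    by (simp add: Q.distr_shear_map distr_lborel_swap)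
  then have "distr ?M borel Q = lborel"
    by (simp add: distr_distr Q_def comp_assoc)
  then have "area_preserving (Q \<circ> inv P.shear_map)"
    by (intro area_preserving_transport[OF P_diffeo _ _ P.distr_shear_map]
        Ck_diffeo_measurable[OF Q_diffeo]) simp_all
  moreover have "Ck_diffeo k (Q \<circ> inv P.shear_map)"
    by (intro Ck_diffeo_comp Ck_diffeo_inv P_diffeo Q_diffeo)
  \<comment> \<open>Where \<open>A y * W x = 0\<close> the first shear fixes the point, so only the
    second acts. This covers all four sides: \<open>A\<close> vanishes at heights 0 and 1, and
    \<open>W\<close> at abscissas 0 and 1. There \<open>a c = 1\<close> gives \<open>f\<close>,
    while \<open>a (1 - c) = 0\<close> and the zeros of \<open>h\<close> give the identity.\<close>
  moreover have T_eq: "(Q \<circ> inv P.shear_map) (x, y) = (x + a y * h x, y)" if "A y * W x = 0" for x y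
  proof -
    have "u (x, y) = y" using that by (auto simp: u_def)
    then have "P.shear_map (x, y) = (x, y)"
      by (simp add: P.shear_map_def)
    then have "inv P.shear_map (x, y) = (x, y)"
      using inv_f_f[OF bij_is_inj[OF P.bij_shear_map], of "(x, y)"] by simp
    moreover have "u' (y, x) = x + a y * h x" by (simp add: u'_def)
    ultimately show ?thesis by (simp add: Q_def Q.shear_map_def)
  qed
  moreover have "h 0 = 0" "h 1 = 0"
    using h(2)[of 0] h(2)[of 1] f by auto
  ultimately show ?thesis
    using A c W01 h(2) by (intro that[of "Q \<circ> inv P.shear_map"]) (auto simp: T_eq simp del: o_apply)
qed

section \<open>From the planar diffeomorphism to an interval diffeomorphism\<close>

lemma real_derivative_unique_Icc:
  fixes f :: "real \<Rightarrow> real"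
  assumes "(f has_real_derivative d) (at x within {a..b})" "(f has_real_derivative d') (at x within {a..b})"
    and "a < b" "x \<in> {a..b}"
  shows "d = d'"
  using assms vector_derivative_unique_within[of x "{a..b}" f d d'] 
  by (simp add: has_real_derivative_iff_has_vector_derivative trivial_limit_within islimpt_Icc)

text \<open>Differentiating \<open>inv f (f x) = x\<close> gives a left inverse \<open>E\<close> of
  \<open>D\<close>.\<close>

lemma Ck_diffeo_derivative_inj:
  assumes f: "Ck_diffeo (Suc n) f" and D: "(f has_derivative D) (at x)" and "D v = 0"
  shows "v = 0"
proof -
  obtain E where E: "(inv f has_derivative E) (at (f x))"
    using f Ck_map_has_derivative unfolding Ck_diffeo_def by blast
  have "((\<lambda>x. inv f (f x)) has_derivative (\<lambda>v. E (D v))) (at x)"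
    by (rule has_derivative_compose[OF D E])
  moreover have "(\<lambda>x. inv f (f x)) = (\<lambda>x. x)"
    using f by (simp add: Ck_diffeo_def bij_is_inj)
  ultimately have "(\<lambda>v. E (D v)) = (\<lambda>v. v)"
    using has_derivative_unique[OF _ has_derivative_ident] by simp
  moreover have "E 0 = 0"
    using linear_0[OF has_derivative_linear[OF E]] .
  ultimately show ?thesis
    using assms(3) by (metis (no_types))
qed

text \<open>Along the side the normal component of the derivative of \<open>\<Psi>\<close> vanishes,
  so injectivity of that derivative forces the tangential component \<open>deriv f\<close> to be
  nonzero. Being continuous and equal to 1 at 0, it is positive, and
  \<open>horizontal_side_extension\<close> applies to \<open>f\<close>.\<close>

lemma square_side_extension:
  assumes \<Psi>: "Ck_diffeo (Suc k) \<Psi>" and c: "c \<in> {0, 1}"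
    and side: "\<And>t. t \<in> {0..1} \<Longrightarrow> snd (\<Psi> (t, c)) = c"
    and ends: "\<And>e. e \<in> {0, 1} \<Longrightarrow> fst (\<Psi> (e, c)) = e"
    and d1: "\<And>e. e \<in> {0, 1} \<Longrightarrow>
      ((\<lambda>t. fst (\<Psi> (t, c))) has_real_derivative 1) (at e within {0..1})"
  obtains T where "Ck_diffeo k T" "area_preserving T"
    "\<And>t. t \<in> {0..1} \<Longrightarrow> T (t, c) = \<Psi> (t, c)"
    "\<And>t. T (t, 1 - c) = (t, 1 - c)" "\<And>t. T (0, t) = (0, t)" "\<And>t. T (1, t) = (1, t)"
proof -
  define f where "f = (\<lambda>t. fst (\<Psi> (t, c)))"
  have \<Psi>_Ck: "Ck_map (Suc k) \<Psi>" using \<Psi> by (simp only: Ck_diffeo_def)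
  have f: "Ck_map (Suc k) f"
    unfolding f_def
    by (intro Ck_map_fst Ck_map_compose[OF \<Psi>_Ck] Ck_map_Pair Ck_map_id Ck_map_const)
  have deriv_ends: "deriv f e = 1" if "e \<in> {0, 1}" for e
    using real_derivative_unique_Icc[of f "deriv f e" e 0 1 1] d1[OF that] that
      DERIV_subset[OF Ck_map_real_SucD(1)[OF f]] by (auto simp: f_def)
  have nz: "deriv f t \<noteq> 0" if t: "t \<in> {0..1}" for t
  proof
    assume f0: "deriv f t = 0"
    define D where "D = frechet_derivative \<Psi> (at (t, c))"
    have D: "(\<Psi> has_derivative D) (at (t, c))"
      unfolding D_def by (rule Ck_map_has_derivative[OF \<Psi>_Ck])
    have "((\<lambda>t. (t, c)) has_derivative (\<lambda>h. (h, 0))) (at t)"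
      by (intro derivative_intros)
    from has_derivative_compose[OF this D]
    have line: "((\<lambda>t. \<Psi> (t, c)) has_derivative (\<lambda>h. D (h, 0))) (at t)" .
    have scale: "D (h, 0) = h *\<^sub>R D (1, 0)" for h
      using linear_scale[OF has_derivative_linear[OF D], of h "(1, 0)"] by simp
    have "(f has_real_derivative fst (D (1, 0))) (at t)"
      using has_derivative_fst[OF line] unfolding f_def has_field_derivative_def
      by (subst (asm) scale) (simp add: mult_commute_abs)
    then have fst0: "fst (D (1, 0)) = 0"
      using f0 by (simp add: DERIV_imp_deriv)
    have "((\<lambda>t. snd (\<Psi> (t, c))) has_real_derivative snd (D (1, 0))) (at t)"
      using has_derivative_snd[OF line] unfolding has_field_derivative_def
      by (subst (asm) scale) (simp add: mult_commute_abs)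
    \<comment> \<open>The second component is known to equal \<open>c\<close> only for
      \<open>t\<close> in [0, 1], so derivatives are compared within that interval, one-sidedly at
      the vertices.\<close>
    then have "((\<lambda>t. snd (\<Psi> (t, c))) has_real_derivative snd (D (1, 0))) (at t within {0..1})"
      by (rule DERIV_subset) simp
    moreover have "((\<lambda>t. snd (\<Psi> (t, c))) has_real_derivative 0) (at t within {0..1})"
      by (rule has_field_derivative_transform_within[OF DERIV_const[of c] zero_less_one t]) (use side in auto)
    ultimately have "snd (D (1, 0)) = 0"
      using t by (intro real_derivative_unique_Icc[of _ _ t 0 1]) auto
    with fst0 have "D (1, 0) = 0" by (simp add: prod_eq_iff)
    then have "(1::real, 0::real) = 0"
      by (rule Ck_diffeo_derivative_inj[OF \<Psi> D])
    then show False by (simp add: zero_prod_def)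
  qed
  have pos: "0 < deriv f t" if t: "t \<in> {0..1}" for t
  proof (rule ccontr)
    assume "\<not> 0 < deriv f t"
    then have "deriv f t \<le> 0" "0 \<le> deriv f 0" "0 \<le> t"
      using deriv_ends t by auto
    moreover have "continuous_on {0..t} (deriv f)"
      using Ck_map_continuous[OF Ck_map_real_SucD(2)[OF f]] by (rule continuous_on_subset) simp
    ultimately obtain s where "0 \<le> s" "s \<le> t" "deriv f s = 0"
      using IVT2'[of "deriv f" t 0 0] by blast
    with nz[of s] t show False by auto
  qed
  have "f 0 = 0" "f 1 = 1" using ends by (auto simp: f_def)
  with f deriv_ends pos c obtain T where T: "Ck_diffeo k T" "area_preserving T"
    "\<And>t. t \<in> {0..1} \<Longrightarrow> T (t, c) = (f t, c)"
    "\<And>t. T (t, 1 - c) = (t, 1 - c)" "\<And>t. T (0, t) = (0, t)" "\<And>t. T (1, t) = (1, t)"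
    using horizontal_side_extension[of k f c] by (metis insertI1 insertI2)
  show ?thesis
    by (rule that[OF T(1,2) _ T(4-6)]) (use T(3) side in \<open>auto simp: f_def prod_eq_iff\<close>)
qed

section \<open>Assembling the four side maps\<close>

lemma square_iff:
  "(x, y) \<in> square \<longleftrightarrow> x \<in> {0..1} \<and> y \<in> {0..1} \<and> (x \<in> {0, 1} \<or> y \<in> {0, 1})"
  by (auto simp: square_def frontier_def interior_Times closure_Times)

theorem theorem4:
  fixes k :: nat and \<phi> :: "real \<times> real \<Rightarrow> real \<times> real"
  assumes "square_diffeo (k + 1) \<phi>"
    and "\<forall>c\<in>{0, 1}. \<phi> ` horizontal_side c = horizontal_side c"
    and "\<forall>c\<in>{0, 1}. \<phi> ` vertical_side c = vertical_side c"
    and "\<forall>c\<in>{0, 1}. \<forall>e\<in>{0, 1}.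
           ((\<lambda>t. fst (\<phi> (t, c))) has_real_derivative 1) (at e within {0..1})"
    and "\<forall>c\<in>{0, 1}. \<forall>e\<in>{0, 1}.
           ((\<lambda>t. snd (\<phi> (c, t))) has_real_derivative 1) (at e within {0..1})"
  shows "\<exists>\<psi>. Ck_diffeo k \<psi> \<and> (\<forall>p\<in>square. \<psi> p = \<phi> p) \<and> area_preserving \<psi>"
proof -
  obtain \<Psi> where \<Psi>: "Ck_diffeo (Suc k) \<Psi>" and eq: "\<And>p. p \<in> square \<Longrightarrow> \<Psi> p = \<phi> p"
    using assms(1) by (auto simp: square_diffeo_def simp del: Ck_map.simps)
  have hor: "\<exists>s\<in>{0..1}. \<phi> (t, c) = (s, c)" if "c \<in> {0, 1}" "t \<in> {0..1}" for c t
  proof -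
    have "\<phi> (t, c) \<in> horizontal_side c"
      using assms(2) that by (metis horizontal_side_def imageI mem_Sigma_iff singletonI)
    then show ?thesis by (auto simp: horizontal_side_def)
  qed
  have ver: "\<exists>s\<in>{0..1}. \<phi> (c, t) = (c, s)" if "c \<in> {0, 1}" "t \<in> {0..1}" for c t
  proof -
    have "\<phi> (c, t) \<in> vertical_side c"
      using assms(3) that by (metis vertical_side_def imageI mem_Sigma_iff singletonI)
    then show ?thesis by (auto simp: vertical_side_def)
  qed
  \<comment> \<open>A vertex lies on a horizontal and a vertical side, and each is mapped to itself,
    so the vertex is fixed.\<close>
  have corner: "\<phi> (e, c) = (e, c)" if "c \<in> {0, 1}" "e \<in> {0, 1}" for c e
    using hor[of c e] ver[of e c] that by force
  have \<Psi>_hor: "\<Psi> (t, c) = \<phi> (t, c)" and \<Psi>_ver: "\<Psi> (c, t) = \<phi> (c, t)"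
    if "c \<in> {0, 1}" "t \<in> {0..1}" for c t
    using that by (auto intro!: eq simp: square_iff)
  have H: "\<exists>T. Ck_diffeo k T \<and> area_preserving T \<and> (\<forall>t\<in>{0..1}. T (t, c) = \<phi> (t, c)) \<and>
      (\<forall>t. T (t, 1 - c) = (t, 1 - c)) \<and> (\<forall>t. T (0, t) = (0, t)) \<and> (\<forall>t. T (1, t) = (1, t))"
    if c: "c \<in> {0, 1}" for c
  proof (rule square_side_extension[OF \<Psi> c])
    show "snd (\<Psi> (t, c)) = c" if "t \<in> {0..1}" for t
      using hor[OF c that] \<Psi>_hor[OF c that] by auto
    fix e :: real assume e: "e \<in> {0, 1}"
    show "fst (\<Psi> (e, c)) = e"
      using corner[OF c e] \<Psi>_hor[OF c, of e] e by auto
    show "((\<lambda>t. fst (\<Psi> (t, c))) has_real_derivative 1) (at e within {0..1})"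
      by (rule has_field_derivative_transform_within[of "\<lambda>t. fst (\<phi> (t, c))" _ _ _ 1])
        (use assms(4) \<Psi>_hor[OF c] c e in auto)
  qed (use \<Psi>_hor[OF c] in auto)
  \<comment> \<open>Conjugation by the swap turns the vertical sides into horizontal ones, so the
    same lemma yields their extensions.\<close>
  define \<Psi>' where "\<Psi>' = prod.swap \<circ> \<Psi> \<circ> prod.swap"
  have \<Psi>': "Ck_diffeo (Suc k) \<Psi>'"
    unfolding \<Psi>'_def by (intro Ck_diffeo_comp Ck_diffeo_swap \<Psi>)
  have \<Psi>'_hor: "\<Psi>' (t, c) = prod.swap (\<phi> (c, t))" if "c \<in> {0, 1}" "t \<in> {0..1}" for c t
    using \<Psi>_ver[OF that] by (simp add: \<Psi>'_def)
  have V: "\<exists>T. Ck_diffeo k T \<and> area_preserving T \<and> (\<forall>t\<in>{0..1}. T (c, t) = \<phi> (c, t)) \<and>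
      (\<forall>t. T (1 - c, t) = (1 - c, t)) \<and> (\<forall>t. T (t, 0) = (t, 0)) \<and> (\<forall>t. T (t, 1) = (t, 1))"
    if c: "c \<in> {0, 1}" for c
  proof (rule square_side_extension[OF \<Psi>' c])
    show "snd (\<Psi>' (t, c)) = c" if "t \<in> {0..1}" for t
      using ver[OF c that] \<Psi>'_hor[OF c that] by auto
    fix e :: real assume e: "e \<in> {0, 1}"
    show "fst (\<Psi>' (e, c)) = e"
      using corner[OF e c] \<Psi>'_hor[OF c, of e] e by auto
    show "((\<lambda>t. fst (\<Psi>' (t, c))) has_real_derivative 1) (at e within {0..1})"
      by (rule has_field_derivative_transform_within[of "\<lambda>t. snd (\<phi> (c, t))" _ _ _ 1])
        (use assms(5) \<Psi>'_hor[OF c] c e in auto)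
  next
    fix T assume T: "Ck_diffeo k T" "area_preserving T"
      "\<And>t. t \<in> {0..1} \<Longrightarrow> T (t, c) = \<Psi>' (t, c)"
      "\<And>t. T (t, 1 - c) = (t, 1 - c)" "\<And>t. T (0, t) = (0, t)" "\<And>t. T (1, t) = (1, t)"
    show ?thesis
      by (rule exI[of _ "prod.swap \<circ> T \<circ> prod.swap"])
        (use T \<Psi>'_hor[OF c] in \<open>auto intro!: Ck_diffeo_comp Ck_diffeo_swap area_preserving_comp area_preserving_swap\<close>)
  qed
  obtain H0 where H0: "Ck_diffeo k H0" "area_preserving H0"
    "\<And>t. t \<in> {0..1} \<Longrightarrow> H0 (t, 0) = \<phi> (t, 0)" "\<And>t. H0 (t, 1) = (t, 1)"
    "\<And>t. H0 (0, t) = (0, t)" "\<And>t. H0 (1, t) = (1, t)"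
    using H[of 0] by auto
  obtain H1 where H1: "Ck_diffeo k H1" "area_preserving H1"
    "\<And>t. t \<in> {0..1} \<Longrightarrow> H1 (t, 1) = \<phi> (t, 1)" "\<And>t. H1 (t, 0) = (t, 0)"
    "\<And>t. H1 (0, t) = (0, t)" "\<And>t. H1 (1, t) = (1, t)"
    using H[of 1] by auto
  obtain V0 where V0: "Ck_diffeo k V0" "area_preserving V0"
    "\<And>t. t \<in> {0..1} \<Longrightarrow> V0 (0, t) = \<phi> (0, t)" "\<And>t. V0 (1, t) = (1, t)"
    "\<And>t. V0 (t, 0) = (t, 0)" "\<And>t. V0 (t, 1) = (t, 1)"
    using V[of 0] by auto
  obtain V1 where V1: "Ck_diffeo k V1" "area_preserving V1"
    "\<And>t. t \<in> {0..1} \<Longrightarrow> V1 (1, t) = \<phi> (1, t)" "\<And>t. V1 (0, t) = (0, t)"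
    "\<And>t. V1 (t, 0) = (t, 0)" "\<And>t. V1 (t, 1) = (t, 1)"
    using V[of 1] by auto
  note T = H0 H1 V0 V1
  \<comment> \<open>Each factor fixes the other three sides pointwise, so at most one factor moves a
    given point of the square. By \<open>hor\<close> and \<open>ver\<close> the image stays on the
    same side, where the factors applied afterwards fix it.\<close>
  define \<psi> where "\<psi> = H0 \<circ> H1 \<circ> V0 \<circ> V1"
  have "\<psi> p = \<phi> p" if "p \<in> square" for p
  proof -
    obtain x y where p: "p = (x, y)" by (cases p)
    have xy: "x \<in> {0..1}" "y \<in> {0..1}" and "x = 0 \<or> x = 1 \<or> y = 0 \<or> y = 1"
      using that by (auto simp: p square_iff)
    then consider "x = 0" | "x = 1" | "y = 0" | "y = 1" by blast
    then show ?thesis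
    proof cases
      case 1
      then show ?thesis using ver[of 0 y] xy by (auto simp: p \<psi>_def T)
    next
      case 2
      then show ?thesis using ver[of 1 y] xy by (auto simp: p \<psi>_def T)
    next
      case 3
      then show ?thesis using xy by (simp add: p \<psi>_def T)
    next
      case 4
      then show ?thesis using hor[of 1 x] xy by (auto simp: p \<psi>_def T)
    qed
  qed
  moreover have "Ck_diffeo k \<psi>" "area_preserving \<psi>"
    unfolding \<psi>_def by (intro Ck_diffeo_comp area_preserving_comp T)+
  ultimately show ?thesis by blast
qed

end
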